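(* Let $n\ge 4$ and $s$ be integers with $2 \leq s \leq \lfloor\frac{n}{2}\rfloor$, and let $S_{n,s}$ be the spire graph. Then $$rn(S_{n,s}) \geq \begin{cases} 2k^2 -4k + 2s +3 & \text{if } n = 2k \text{ and } 2 \leq s \leq k-2,\\ 2k^2 -2k & \text{if } n = 2k \text{ and } s= k-1,\\ 2k^2 -2k + 1 & \text{if } n = 2k \text{ and } s= k,\\ 2k^2 -2k + 2s & \text{if } n = 2k + 1. \end{cases}$$
   Context: For a connected graph $G$, $d(u,v)$ denotes the graph distance and $\mathrm{diam}(G)$ the diameter. A radio labeling of $G$ is a function $c:V(G)\to\mathbb{Z}_{+}$ (positive integers; $0$ is not allowed) such that for all distinct $u,v\in V(G)$, $d(u,v)+|c(u)-c(v)|\ge \mathrm{diam}(G)+1$. The span of $c$ is the maximum value of $c$, and the radio number $rn(G)$ is the minimum span over all radio labelings of $G$. For integers $n\ge 4$ and $2\le s\le n-2$, the spire graph $S_{n,s}$ has vertices $v_1,\dots,v_n$ and edges $\{v_i,v_{i+1}\}$ for $i=1,\dots,n-2$ together with the edge $\{v_s,v_n\}$. *)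

theory Defs
  imports Main
begin

text \<open>A simple graph is given by its vertex set \<open>V\<close> and its set \<open>E\<close> of two-element edges.\<close>

definition adj_rel :: "'a set set \<Rightarrow> ('a \<times> 'a) set" where
  "adj_rel E = {(u, v). {u, v} \<in> E}"

text \<open>Length of a shortest walk. Meaningful only if \<open>u\<close> and \<open>v\<close> are joined by a walk;
  otherwise \<open>LEAST\<close> ranges over no number.\<close>

definition graph_dist :: "'a set set \<Rightarrow> 'a \<Rightarrow> 'a \<Rightarrow> nat" where
  "graph_dist E u v = (LEAST k. (u, v) \<in> adj_rel E ^^ k)"

definition graph_diam :: "'a set \<Rightarrow> 'a set set \<Rightarrow> nat" where
  "graph_diam V E = Max {graph_dist E u v | u v. u \<in> V \<and> v \<in> V}"

definition radio_labeling :: "'a set \<Rightarrow> 'a set set \<Rightarrow> ('a \<Rightarrow> nat) \<Rightarrow> bool" where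
  "radio_labeling V E c \<longleftrightarrow>
     (\<forall>v\<in>V. c v > 0) \<and>
     (\<forall>u\<in>V. \<forall>v\<in>V. u \<noteq> v \<longrightarrow>
        int (graph_dist E u v) + \<bar>int (c u) - int (c v)\<bar> \<ge> int (graph_diam V E) + 1)"

definition label_span :: "'a set \<Rightarrow> ('a \<Rightarrow> nat) \<Rightarrow> nat" where
  "label_span V c = Max (c ` V)"

definition radio_number :: "'a set \<Rightarrow> 'a set set \<Rightarrow> nat" where
  "radio_number V E = (LEAST m. \<exists>c. radio_labeling V E c \<and> label_span V c = m)"

text \<open>The vertex \<open>v\<^sub>i\<close> of the spire graph is the number \<open>i\<close>.\<close>

definition spire_verts :: "nat \<Rightarrow> nat set" where
  "spire_verts n = {1..n}"

definition spire_edges :: "nat \<Rightarrow> nat \<Rightarrow> nat set set" where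
  "spire_edges n s = {{i, i + 1} | i. 1 \<le> i \<and> i \<le> n - 2} \<union> {{s, n}}"

text \<open>The next two facts show that \<open>LEAST\<close> in \<open>graph_dist\<close> and in \<open>radio_number\<close> is always
  attained for a spire graph.\<close>

lemma spire_connected:
  assumes "n \<ge> 4" "2 \<le> s" "s \<le> n - 2" "u \<in> spire_verts n" "v \<in> spire_verts n"
  shows "(u, v) \<in> (adj_rel (spire_edges n s))\<^sup>*"
proof -
  let ?R = "adj_rel (spire_edges n s)"
  have "sym ?R"
    by (auto simp: sym_def adj_rel_def insert_commute)
  then have sym: "sym (?R\<^sup>*)"
    by (rule sym_rtrancl)
  have path: "(1, Suc i) \<in> ?R\<^sup>*" if "Suc i \<le> n - 1" for i
    using that
  proof (induction i)
    case (Suc i)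
    have "{Suc i, Suc i + 1} \<in> spire_edges n s"
      unfolding spire_edges_def using Suc.prems by (intro UnI1 CollectI exI[of _ "Suc i"]) auto
    then have "(Suc i, Suc (Suc i)) \<in> ?R"
      by (simp add: adj_rel_def)
    with Suc show ?case
      by (auto intro: rtrancl_into_rtrancl)
  qed simp
  have from_one: "(1, w) \<in> ?R\<^sup>*" if "w \<in> spire_verts n" for w
  proof (cases "w = n")
    case True
    have "(1, s) \<in> ?R\<^sup>*"
      using path[of "s - 1"] assms(2,3) by simp
    moreover have "(s, n) \<in> ?R"
      by (simp add: adj_rel_def spire_edges_def)
    ultimately show ?thesis
      using True by (auto intro: rtrancl_into_rtrancl)
  next
    case False
    then show ?thesis
      using path[of "w - 1"] that by (cases w) (auto simp: spire_verts_def)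
  qed
  show ?thesis
    using from_one[OF assms(4)] from_one[OF assms(5)] sym
    by (meson rtrancl_trans symD)
qed

lemma radio_labeling_exists:
  assumes "finite V"
  shows "\<exists>c. radio_labeling V E c"
proof -
  obtain f :: "'a \<Rightarrow> nat" where f: "inj_on f V"
    using finite_imp_inj_to_nat_seg[OF assms] by blast
  define D where "D = int (graph_diam V E) + 1"
  have "\<bar>int (Suc (f u) * nat D) - int (Suc (f v) * nat D)\<bar> \<ge> D"
    if "u \<in> V" "v \<in> V" "u \<noteq> v" for u v
  proof -
    have "f u \<noteq> f v"
      using f that by (auto dest: inj_onD)
    then have "\<bar>int (f u) - int (f v)\<bar> \<ge> 1"
      by linarith
    moreover have "D > 0"
      by (simp add: D_def)
    moreover from this have "int (Suc (f u) * nat D) - int (Suc (f v) * nat D)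
        = (int (f u) - int (f v)) * D"
      by (simp add: algebra_simps)
    ultimately show ?thesis
      using mult_right_mono[of 1 "\<bar>int (f u) - int (f v)\<bar>" D] by (simp add: abs_mult)
  qed
  then have "radio_labeling V E (\<lambda>v. Suc (f v) * nat D)"
    unfolding radio_labeling_def D_def by (fastforce intro: add_increasing)
  then show ?thesis by blast
qed

end

theory Submission
  imports Defs
begin

text \<open>Order the vertices by label as \<open>x\<^sub>0, \<dots>, x\<^sub>m\<close> with \<open>m = n - 1\<close> and let \<open>w\<close> be the distance to
  the vertex \<open>v\<^sub>k\<close>. Since \<open>d(u,v) \<le> w(u) + w(v)\<close>, every gap between consecutive labels is at least
  \<open>n - 1 - w(x\<^sub>i) - w(x\<^sub>i\<^sub>+\<^sub>1)\<close>; summing shows that the largest label is at least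
  \<open>m\<^sup>2 - 2 W + w(x\<^sub>0) + w(x\<^sub>m) + 1\<close> plus the total slack, where \<open>W\<close> is the sum of all weights, and
  \<open>w(x\<^sub>0) + w(x\<^sub>m) \<ge> 1\<close>. This settles the cases \<open>n = 2k + 1\<close> and \<open>s = k\<close>.

  For \<open>n = 2k\<close> and \<open>s < k\<close> some further slack is unavoidable. If it is at most 1, consecutive vertices
  lie on opposite sides of \<open>v\<^sub>k\<close>. The left side has one vertex more than the right side, which forces
  the neighbours of \<open>v\<^sub>k\<close> in the ordering to be on the left, so the far right vertices
  \<open>v\<^sub>2\<^sub>k\<^sub>-\<^sub>1\<close> and \<open>v\<^sub>2\<^sub>k\<^sub>-\<^sub>2\<close> sit between two left ones. Comparing these two left vertices with
  each other gives the missing slack.\<close>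

section \<open>Distances in the spire\<close>

text \<open>Projection onto the path \<open>1, ..., n - 1\<close>: the pendant vertex
  \<open>n\<close> projects to its attachment point \<open>s\<close>.\<close>

definition foot :: "nat \<Rightarrow> nat \<Rightarrow> nat \<Rightarrow> nat" where
  "foot n s u = (if u = n then s else u)"

definition stem :: "nat \<Rightarrow> nat \<Rightarrow> nat" where
  "stem n u = (if u = n then 1 else 0)"

text \<open>The distance of \<open>u \<noteq> v\<close>; on the diagonal it has the value 2 for the pendant vertex.\<close>

definition spire_dist :: "nat \<Rightarrow> nat \<Rightarrow> nat \<Rightarrow> nat \<Rightarrow> int" where
  "spire_dist n s u v =
     \<bar>int (foot n s u) - int (foot n s v)\<bar> + int (stem n u) + int (stem n v)"

lemma sym_adj_rel: "sym (adj_rel E)"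
  by (auto simp: sym_def adj_rel_def insert_commute)

lemma relpow_sym:
  assumes "sym R" "(u, v) \<in> R ^^ j"
  shows "(v, u) \<in> R ^^ j"
  using assms(2)
proof (induction j arbitrary: v)
  case (Suc j)
  then obtain y where "(u, y) \<in> R ^^ j" "(y, v) \<in> R"
    by auto
  then show ?case
    using Suc.IH assms(1) by (meson relpow_Suc_I2 symD)
qed simp

lemma spire_path_walk:
  assumes "1 \<le> i" "i + j \<le> n - 1"
  shows "(i, i + j) \<in> adj_rel (spire_edges n s) ^^ j"
  using assms(2)
proof (induction j)
  case (Suc j)
  have "{i + j, i + j + 1} \<in> spire_edges n s"
    unfolding spire_edges_def using Suc.prems assms(1) by (intro UnI1 CollectI exI[of _ "i + j"]) auto
  then have "(i + j, i + Suc j) \<in> adj_rel (spire_edges n s)"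
    by (simp add: adj_rel_def)
  with Suc show ?case
    by (auto intro: relpow_Suc_I)
qed simp

lemma spire_walk:
  assumes "2 \<le> s" "s \<le> n - 2" "u \<in> spire_verts n" "v \<in> spire_verts n"
  shows "(u, v) \<in> adj_rel (spire_edges n s) ^^ nat (spire_dist n s u v)"
proof -
  let ?R = "adj_rel (spire_edges n s)"
  have stem: "(a, foot n s a) \<in> ?R ^^ stem n a" for a
    by (auto simp: foot_def stem_def adj_rel_def spire_edges_def insert_commute)
  have up: "(a, b) \<in> ?R ^^ nat \<bar>int a - int b\<bar>" if "1 \<le> a" "a \<le> b" "b \<le> n - 1" for a b
    using spire_path_walk[of a "b - a" n s] that by (simp add: nat_diff_distrib' abs_if)
  have path: "(a, b) \<in> ?R ^^ nat \<bar>int a - int b\<bar>"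
    if "1 \<le> a" "1 \<le> b" "a \<le> n - 1" "b \<le> n - 1" for a b
    using up[of a b] relpow_sym[OF sym_adj_rel up[of b a]] that
    by (metis abs_minus_commute nat_le_linear)
  have "(foot n s u, foot n s v) \<in> ?R ^^ nat \<bar>int (foot n s u) - int (foot n s v)\<bar>"
    using assms by (intro path) (auto simp: foot_def spire_verts_def)
  from relpow_trans[OF relpow_trans[OF stem this] relpow_sym[OF sym_adj_rel stem]]
  show ?thesis
    by (simp add: spire_dist_def nat_add_distrib algebra_simps)
qed

text \<open>Only this direction enters the radio condition: replacing the distance by an upper bound
  weakens the required label gap.\<close>

lemma graph_dist_le_spire_dist:
  assumes "2 \<le> s" "s \<le> n - 2" "u \<in> spire_verts n" "v \<in> spire_verts n"
  shows "int (graph_dist (spire_edges n s) u v) \<le> spire_dist n s u v"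
proof -
  have "graph_dist (spire_edges n s) u v \<le> nat (spire_dist n s u v)"
    unfolding graph_dist_def by (rule Least_le) (rule spire_walk[OF assms])
  then show ?thesis
    by (simp add: spire_dist_def)
qed

text \<open>Each edge moves the projection to the path by at most 1, and the edge
  \<open>{s, n}\<close> does not move it at all.\<close>

lemma foot_diff_le_walk_length:
  assumes "(u, v) \<in> adj_rel (spire_edges n s) ^^ j" "s \<le> n - 2" "n \<ge> 4"
  shows "\<bar>int (foot n s u) - int (foot n s v)\<bar> \<le> int j"
  using assms(1)
proof (induction j arbitrary: v)
  case (Suc j)
  then obtain y where y: "(u, y) \<in> adj_rel (spire_edges n s) ^^ j" "(y, v) \<in> adj_rel (spire_edges n s)"
    by auto
  have "\<bar>int (foot n s y) - int (foot n s v)\<bar> \<le> 1"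
    using y(2) assms(2,3) by (auto simp: adj_rel_def spire_edges_def foot_def doubleton_eq_iff)
  with Suc.IH[OF y(1)] show ?case
    by linarith
qed simp

text \<open>The ends \<open>1\<close> and \<open>n - 1\<close> of the path witness this bound. It
  turns the radio condition into a label gap of at least \<open>n - 1\<close> minus the
  distance.\<close>

lemma spire_diam_ge:
  assumes "n \<ge> 4" "2 \<le> s" "s \<le> n - 2"
  shows "graph_diam (spire_verts n) (spire_edges n s) \<ge> n - 2"
proof -
  let ?E = "spire_edges n s" and ?V = "spire_verts n"
  have mem: "1 \<in> ?V" "n - 1 \<in> ?V"
    using assms by (auto simp: spire_verts_def)
  obtain j where "(1, n - 1) \<in> adj_rel ?E ^^ j"
    using spire_connected[OF assms mem] by (meson rtrancl_imp_relpow)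
  then have "(1, n - 1) \<in> adj_rel ?E ^^ graph_dist ?E 1 (n - 1)"
    unfolding graph_dist_def by (rule LeastI)
  from foot_diff_le_walk_length[OF this] have "n - 2 \<le> graph_dist ?E 1 (n - 1)"
    using assms by (auto simp: foot_def split: if_splits)
  also have "finite {graph_dist ?E u v | u v. u \<in> ?V \<and> v \<in> ?V}"
    by (rule finite_image_set2) (auto simp: spire_verts_def)
  then have "graph_dist ?E 1 (n - 1) \<le> graph_diam ?V ?E"
    unfolding graph_diam_def using mem by (intro Max_ge) auto
  finally show ?thesis .
qed

section \<open>Vertices ordered by label\<close>

lemma sum_abs_diff_center:
  "2 * (\<Sum>u = 1..k + j. \<bar>int u - int k\<bar>) = int k * (int k - 1) + int j * (int j + 1)"
proof (induction j)
  case 0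
  \<comment> \<open>The upper limit is freed from \<open>k\<close>, since an induction on
    \<open>k\<close> itself would shift the centre.\<close>
  have "2 * (\<Sum>u = 1..m. \<bar>int u - int k\<bar>) = int m * (2 * int k - int m - 1)" if "m \<le> k" for m
    using that by (induction m) (auto simp: algebra_simps)
  from this[of k] show ?case
    by (simp add: algebra_simps)
qed (simp add: algebra_simps)

lemma sum_consecutive:
  fixes f :: "nat \<Rightarrow> int"
  shows "(\<Sum>i<m. f i + f (Suc i)) = 2 * (\<Sum>i<Suc m. f i) - f 0 - f m"
  by (induction m) auto

text \<open>In \<open>radio\<close> the absolute value is gone because labels increase along
  \<open>x\<close>, and the diameter and the distance are replaced by their bounds
  \<open>n - 2\<close> and \<open>spire_dist\<close>.\<close>

locale spire_ordering =
  fixes n s k :: nat and x :: "nat \<Rightarrow> nat" and c :: "nat \<Rightarrow> int"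
  assumes n_ge: "n \<ge> 4" and s_ge: "2 \<le> s" and s_le: "s \<le> k"
    and n_eq: "n = 2 * k \<or> n = 2 * k + 1"
    and bij: "bij_betw x {..<n} {1..n}"
    and first: "c (x 0) \<ge> 1"
    and radio: "i < j \<Longrightarrow> j < n \<Longrightarrow> c (x j) - c (x i) \<ge> int n - 1 - spire_dist n s (x i) (x j)"
begin

definition weight :: "nat \<Rightarrow> int" where
  "weight u = \<bar>int (foot n s u) - int k\<bar> + int (stem n u)"

text \<open>The value is 1 to the left of the centre and -1 to the right. It is 0 at the centre, and
  also at the pendant vertex when \<open>s = k\<close>.\<close>

definition side :: "nat \<Rightarrow> int" where
  "side u = sgn (int k - int (foot n s u))"

definition slack :: "nat \<Rightarrow> int" where
  "slack i = c (x (Suc i)) - c (x i) - (int n - 1) + weight (x i) + weight (x (Suc i))"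

lemma weight_nonneg: "weight u \<ge> 0"
  by (simp add: weight_def)

lemma weight_eq_0_iff: "weight u = 0 \<longleftrightarrow> u = k"
  using n_ge n_eq by (auto simp: weight_def foot_def stem_def)

lemma x_range: "i < n \<Longrightarrow> 1 \<le> x i \<and> x i \<le> n"
  using bij by (auto simp: bij_betw_def)

lemma x_eq_iff: "i < n \<Longrightarrow> j < n \<Longrightarrow> x i = x j \<longleftrightarrow> i = j"
  using bij by (auto simp: bij_betw_def inj_on_def)

lemma x_surj: "1 \<le> u \<Longrightarrow> u \<le> n \<Longrightarrow> \<exists>i<n. x i = u"
  using bij_betw_imp_surj_on[OF bij] by (metis atLeastAtMost_iff imageE lessThan_iff)

lemma sum_x: "(\<Sum>i<n. f (x i)) = (\<Sum>u = 1..n. f u)"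
  using sum.reindex_bij_betw[OF bij] .

lemma slack_nonneg: "Suc i < n \<Longrightarrow> slack i \<ge> 0"
  using radio[of i "Suc i"] unfolding slack_def weight_def spire_dist_def by linarith

text \<open>For two vertices on one side the route through \<open>k\<close> exceeds
  \<open>spire_dist\<close> by twice the smaller distance of their feet from \<open>k\<close>, which
  is at least 1.\<close>

lemma slack_same_side:
  assumes "Suc i < n" "side (x i) = side (x (Suc i))" "x i \<noteq> k" "s < k"
  shows "slack i \<ge> 2"
  using radio[of i "Suc i"] assms n_eq n_ge
  unfolding slack_def weight_def spire_dist_def side_def foot_def stem_def sgn_if
  by (auto split: if_splits)

lemma sum_slack_mono:
  assumes "I \<subseteq> {i. Suc i < n}"
  shows "sum slack I \<le> sum slack {..<n - 1}"
  using assms by (intro sum_mono2) (auto intro: slack_nonneg simp: less_diff_conv)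

lemma sum_weight:
  "2 * (\<Sum>u = 1..n. weight u) = int k * (int k - 1)
     + int (n - 1 - k) * (int (n - 1 - k) + 1) + 2 * (int k - int s + 1)"
proof -
  have "{1..n} = insert n {1..k + (n - 1 - k)}"
    using n_ge n_eq by auto
  moreover have "(\<Sum>u = 1..k + (n - 1 - k). weight u) = (\<Sum>u = 1..k + (n - 1 - k). \<bar>int u - int k\<bar>)"
    using n_ge n_eq by (intro sum.cong) (auto simp: weight_def foot_def stem_def)
  moreover have "weight n = int k - int s + 1"
    using s_le by (simp add: weight_def foot_def stem_def)
  moreover have "n \<notin> {1..k + (n - 1 - k)}"
    using n_ge n_eq by auto
  ultimately show ?thesis
    using sum_abs_diff_center[of k "n - 1 - k"] by (simp add: algebra_simps)
qed

text \<open>The \<open>n - 1\<close> gaps telescope, and every weight is counted twice except at the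
  two ends.\<close>

lemma last_label:
  "c (x (n - 1)) = c (x 0) + (int n - 1)\<^sup>2 - 2 * (\<Sum>u = 1..n. weight u)
     + (\<Sum>i<n - 1. slack i) + weight (x 0) + weight (x (n - 1))"
proof -
  define m where "m = n - 1"
  have n: "n = Suc m"
    using n_ge by (simp add: m_def)
  have "slack i = (c (x (Suc i)) - c (x i)) - int m + (weight (x i) + weight (x (Suc i)))" for i
    unfolding slack_def using n by linarith
  then have "(\<Sum>i<m. slack i) = (\<Sum>i<m. c (x (Suc i)) - c (x i)) - int m * int m
      + (\<Sum>i<m. weight (x i) + weight (x (Suc i)))"
    by (simp only: sum.distrib sum_subtractf) simp
  also have "(\<Sum>i<m. c (x (Suc i)) - c (x i)) = c (x m) - c (x 0)"
    by (rule sum_lessThan_telescope)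
  also have "(\<Sum>i<m. weight (x i) + weight (x (Suc i)))
      = 2 * (\<Sum>u = 1..n. weight u) - weight (x 0) - weight (x m)"
    using sum_consecutive[of "\<lambda>i. weight (x i)" m] sum_x[of weight] n by simp
  moreover have "int n - 1 = int m"
    using n by simp
  ultimately show ?thesis
    unfolding m_def[symmetric] by (simp add: power2_eq_square)
qed

text \<open>Only the centre has weight 0, and it cannot be both ends.\<close>

lemma end_weights: "weight (x 0) + weight (x (n - 1)) \<ge> 1"
proof (rule ccontr)
  assume "\<not> ?thesis"
  then have "weight (x 0) = 0" "weight (x (n - 1)) = 0"
    using weight_nonneg[of "x 0"] weight_nonneg[of "x (n - 1)"] by linarith+
  then show False
    using weight_eq_0_iff x_eq_iff[of 0 "n - 1"] n_ge by auto
qed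

lemma last_label_ge:
  "c (x (n - 1)) \<ge> 1 + (int n - 1)\<^sup>2 - 2 * (\<Sum>u = 1..n. weight u)
     + (\<Sum>i<n - 1. slack i) + weight (x 0) + weight (x (n - 1))"
  using last_label first by linarith

lemma sum_slack_nonneg: "(\<Sum>i<n - 1. slack i) \<ge> 0"
  by (intro sum_nonneg slack_nonneg) auto

lemma last_label_odd:
  assumes "n = 2 * k + 1"
  shows "c (x (n - 1)) \<ge> 2 * int k ^ 2 - 2 * int k + 2 * int s"
  using last_label_ge end_weights sum_slack_nonneg sum_weight assms
  by (simp add: power2_eq_square algebra_simps)

lemma last_label_even:
  assumes "n = 2 * k"
  shows "c (x (n - 1)) \<ge> 2 * int k ^ 2 - 4 * int k + 2 * int s
           + ((\<Sum>i<n - 1. slack i) + weight (x 0) + weight (x (n - 1)))"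
  using last_label_ge sum_weight assms n_ge
  by (simp add: power2_eq_square algebra_simps of_nat_diff)

end

section \<open>Extra slack for an even number of vertices\<close>

lemma sum_sgn_center:
  assumes "1 \<le> k"
  shows "(\<Sum>u = 1..k + j. sgn (int k - int u)) = int k - 1 - int j"
proof (induction j)
  case 0
  have "{1..k} = insert k {1..<k}"
    using assms by auto
  moreover have "(\<Sum>u = 1..<k. sgn (int k - int u)) = (\<Sum>u = 1..<k. 1)"
    by (intro sum.cong) auto
  ultimately show ?case
    using assms by (simp add: of_nat_diff)
qed simp

text \<open>With \<open>s < k\<close> the pendant vertex is strictly left, so there are
  \<open>k\<close> left vertices and \<open>k - 1\<close> right ones.\<close>

locale even_spire_ordering = spire_ordering +
  assumes n_even: "n = 2 * k" and s_less: "s < k"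
begin

lemma side_eq_0_iff: "side u = 0 \<longleftrightarrow> u = k"
  unfolding side_def foot_def sgn_if using n_ge n_even s_less by auto

lemma side_cases: "side u = 1 \<or> side u = -1 \<or> side u = 0"
  by (auto simp: side_def sgn_if)

lemma sum_side: "(\<Sum>u = 1..n. side u) = 1"
proof -
  have "{1..n} = insert n {1..k + (k - 1)}" "n \<notin> {1..k + (k - 1)}"
    using n_ge n_even by auto
  moreover have "(\<Sum>u = 1..k + (k - 1). side u) = (\<Sum>u = 1..k + (k - 1). sgn (int k - int u))"
    unfolding side_def foot_def using n_ge n_even by (intro sum.cong) auto
  moreover have "side n = 1"
    using s_less by (simp add: side_def foot_def)
  ultimately show ?thesis
    using sum_sgn_center[of k "k - 1"] n_ge n_even by (simp add: of_nat_diff)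
qed

section \<open>Alternation of sides around the centre\<close>

lemma sides_alternate:
  assumes "(\<Sum>i<n - 1. slack i) \<le> 1" "Suc i < n" "x i \<noteq> k" "x (Suc i) \<noteq> k"
  shows "side (x i) + side (x (Suc i)) = 0"
proof (rule ccontr)
  assume "\<not> ?thesis"
  then have "side (x i) = side (x (Suc i))"
    using side_cases[of "x i"] side_cases[of "x (Suc i)"] side_eq_0_iff[of "x i"]
      side_eq_0_iff[of "x (Suc i)"] assms(3,4) by auto
  then have "slack i \<ge> 2"
    using slack_same_side assms s_less by blast
  then show False
    using sum_slack_mono[of "{i}"] assms(1,2) by simp
qed

text \<open>Double counting: \<open>\<Sum>(side x\<^sub>i + side x\<^sub>i\<^sub>+\<^sub>1)\<close> only sees the neighbours of the centre, and equals
  twice the total side, which is 1, minus the sides of the two end vertices.\<close>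

lemma center_neighbours_left:
  assumes slack: "(\<Sum>i<n - 1. slack i) \<le> 1" and p: "p < n" "x p = k"
    and ends: "x 0 = k \<or> x (n - 1) = k \<or> side (x 0) + side (x (n - 1)) = 0"
  shows "Suc p < n \<Longrightarrow> side (x (Suc p)) = 1" "0 < p \<Longrightarrow> side (x (p - 1)) = 1"
    "p = 0 \<Longrightarrow> side (x (n - 1)) = 1" "p = n - 1 \<Longrightarrow> side (x 0) = 1"
proof -
  define m where "m = n - 1"
  have m: "n = Suc m" "m \<ge> 3"
    using n_ge by (auto simp: m_def)
  let ?t = "\<lambda>i. side (x i) + side (x (Suc i))"
  have "(\<Sum>i<m. ?t i) = 2 * (\<Sum>i<n. side (x i)) - side (x 0) - side (x m)"
    using sum_consecutive[of "\<lambda>i. side (x i)" m] m(1) by simp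
  then have total: "(\<Sum>i<m. ?t i) = 2 - side (x 0) - side (x m)"
    using sum_x[of side] sum_side by simp
  have zero: "?t i = 0" if "i < m" "i \<noteq> p" "Suc i \<noteq> p" for i
    using sides_alternate[OF slack, of i] x_eq_iff[of i p] x_eq_iff[of "Suc i" p] that p m by auto
  have near: "(\<Sum>i<m. ?t i) = sum ?t ({..<m} \<inter> {p - 1, p})"
  proof (rule sum.mono_neutral_right)
    show "\<forall>i\<in>{..<m} - {..<m} \<inter> {p - 1, p}. ?t i = 0"
    proof
      fix i
      assume "i \<in> {..<m} - {..<m} \<inter> {p - 1, p}"
      then have "i < m" "i \<noteq> p" "Suc i \<noteq> p"
        by auto
      then show "?t i = 0"
        by (rule zero)
    qed
  qed auto
  have side_p: "side (x p) = 0"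
    using p side_eq_0_iff by simp
  have le1: "side u \<le> 1" for u
    using side_cases[of u] by auto
  \<comment> \<open>In every case two sides, each at most 1, add up to 2, so both are 1. If the
    centre is an end, the second of them belongs to the opposite end.\<close>
  consider "p = 0" | "p = m" | "0 < p" "p < m"
    using p m by linarith
  then have "(Suc p < n \<longrightarrow> side (x (Suc p)) = 1) \<and> (0 < p \<longrightarrow> side (x (p - 1)) = 1) \<and>
      (p = 0 \<longrightarrow> side (x m) = 1) \<and> (p = m \<longrightarrow> side (x 0) = 1)"
  proof cases
    case 1
    then have "{..<m} \<inter> {p - 1, p} = {0}"
      using m by auto
    then have "side (x 1) = 2 - side (x m)"
      using near total side_p 1 by simp
    then show ?thesis
      using 1 le1[of "x 1"] le1[of "x m"] m by auto
  next
    case 2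
    then have "{..<m} \<inter> {p - 1, p} = {m - 1}"
      using m by auto
    then have "side (x (m - 1)) = 2 - side (x 0)"
      using near total side_p 2 m by simp
    then show ?thesis
      using 2 le1[of "x (m - 1)"] le1[of "x 0"] m by auto
  next
    case 3
    then have "{..<m} \<inter> {p - 1, p} = {p - 1, p}"
      by auto
    then have "side (x (p - 1)) + side (x (Suc p)) = 2 - side (x 0) - side (x m)"
      using near total side_p 3 by simp
    moreover have "x 0 \<noteq> k" "x m \<noteq> k"
      using x_eq_iff[of 0 p] x_eq_iff[of m p] 3 p m by auto
    ultimately show ?thesis
      using 3 ends le1[of "x (p - 1)"] le1[of "x (Suc p)"] by (auto simp: m_def)
  qed
  then show "Suc p < n \<Longrightarrow> side (x (Suc p)) = 1" "0 < p \<Longrightarrow> side (x (p - 1)) = 1"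
    "p = 0 \<Longrightarrow> side (x (n - 1)) = 1" "p = n - 1 \<Longrightarrow> side (x 0) = 1"
    unfolding m_def by blast+
qed

text \<open>The neighbours of the centre are left, and so is the end opposite a centre that is
  itself an end. Hence a right vertex as in \<open>q\<close> has two neighbours in the ordering,
  neither of them the centre, and alternation puts both on the left.\<close>

lemma right_between_left:
  assumes slack: "(\<Sum>i<n - 1. slack i) \<le> 1"
    and ends: "x 0 = k \<or> x (n - 1) = k \<or> side (x 0) + side (x (n - 1)) = 0"
    and q: "q < n" "side (x q) = -1" "x 0 = k \<or> x (n - 1) = k \<or> 0 < q \<and> q < n - 1"
  obtains i where "q = Suc i" "Suc (Suc i) < n" "side (x i) = 1" "side (x (Suc (Suc i))) = 1"
proof -
  obtain p where p: "p < n" "x p = k"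
    using x_surj[of k] n_ge n_even by auto
  note left = center_neighbours_left[OF slack p ends]
  have q_p: "q \<noteq> p" "Suc q \<noteq> p" "q \<noteq> Suc p"
    using left(1,2) p q side_eq_0_iff[of "x q"] by auto
  have inner: "0 < q" "q < n - 1"
  proof -
    have "p = 0 \<or> p = n - 1 \<or> 0 < q \<and> q < n - 1"
      using q(3) x_eq_iff[of 0 p] x_eq_iff[of "n - 1" p] p n_ge by auto
    moreover have "side (x (n - 1)) = 1 \<Longrightarrow> q \<noteq> n - 1" "side (x 0) = 1 \<Longrightarrow> q \<noteq> 0"
      using q(2) by (intro notI; simp)+
    ultimately have "0 < q \<and> q < n - 1"
      using left(3,4) q(1) q_p(1) by linarith
    then show "0 < q" "q < n - 1"
      by simp_all
  qed
  then obtain i where i: "q = Suc i"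
    by (cases q) auto
  have "side (x i) + side (x (Suc i)) = 0" "side (x (Suc i)) + side (x (Suc (Suc i))) = 0"
    using sides_alternate[OF slack, of i] sides_alternate[OF slack, of "Suc i"] i inner q_p p
      x_eq_iff[of i p] x_eq_iff[of "Suc i" p] x_eq_iff[of "Suc (Suc i)" p] by simp_all
  then show thesis
    using that[of i] i inner q by auto
qed

section \<open>Slack forced by a right vertex between two left ones\<close>

text \<open>The radio condition is applied to the two outer vertices. If their feet lie
  \<open>a\<close> and \<open>b\<close> to the left of \<open>k\<close>, then
  \<open>a + b - \<bar>a - b\<bar> = 2 * min a b\<close>, and the stems cancel.\<close>

lemma triple_slack:
  assumes "Suc (Suc i) < n" "side (x i) = 1" "side (x (Suc (Suc i))) = 1"
  shows "slack i + slack (Suc i) \<ge> 2 * weight (x (Suc i))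
           + 2 * min (int k - int (foot n s (x i))) (int k - int (foot n s (x (Suc (Suc i)))))
           - (2 * int k - 1)"
proof -
  have "foot n s (x i) < k" "foot n s (x (Suc (Suc i))) < k"
    using assms(2,3) by (auto simp: side_def sgn_if split: if_splits)
  then show ?thesis
    using radio[of i "Suc (Suc i)"] assms(1) n_even
    unfolding slack_def weight_def spire_dist_def by (auto simp: abs_if min_def)
qed

lemma triple_slack_far_right:
  assumes "Suc (Suc i) < n" "side (x i) = 1" "side (x (Suc (Suc i))) = 1"
    and "x (Suc i) = 2 * k - 1"
  shows "slack i + slack (Suc i) \<ge> 1"
proof -
  have "weight (x (Suc i)) = int k - 1"
    unfolding weight_def foot_def stem_def using n_even n_ge assms(4) by auto
  moreover have "foot n s (x i) < k" "foot n s (x (Suc (Suc i))) < k"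
    using assms(2,3) by (auto simp: side_def sgn_if split: if_splits)
  ultimately show ?thesis
    using triple_slack[OF assms(1-3)] by (auto simp: min_def split: if_splits)
qed

text \<open>The threshold is the bound of \<open>triple_slack\<close> for a minimum of 2, so below
  it some foot is \<open>k - 1\<close>. As \<open>s \<le> k - 2\<close>, this foot is not that of
  the pendant vertex.\<close>

lemma left_neighbour_adjacent_center:
  assumes "s + 2 \<le> k" "Suc (Suc i) < n" "side (x i) = 1" "side (x (Suc (Suc i))) = 1"
    and "slack i + slack (Suc i) < 2 * (weight (x (Suc i)) - int k) + 5"
  shows "x i = k - 1 \<or> x (Suc (Suc i)) = k - 1"
proof -
  have less: "foot n s (x i) < k" "foot n s (x (Suc (Suc i))) < k"
    using assms(3,4) by (auto simp: side_def sgn_if split: if_splits)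
  have "min (int k - int (foot n s (x i))) (int k - int (foot n s (x (Suc (Suc i))))) < 2"
    using triple_slack[OF assms(2-4)] assms(5) by (auto simp: min_def split: if_splits)
  then have "foot n s (x i) = k - 1 \<or> foot n s (x (Suc (Suc i))) = k - 1"
    using less by linarith
  then show ?thesis
    using assms(1) by (auto simp: foot_def split: if_splits)
qed

lemma side_far_right: "side (2 * k - 1) = -1"
  unfolding side_def foot_def sgn_if using n_even n_ge by auto

section \<open>Total slack plus end weights\<close>

text \<open>An excess of 1 means no slack and the centre at an end, but then the triple around
  \<open>2 * k - 1\<close> already costs 1.\<close>

lemma excess_ge_2: "(\<Sum>i<n - 1. slack i) + weight (x 0) + weight (x (n - 1)) \<ge> 2"
proof (rule ccontr)
  assume "\<not> ?thesis"
  then have sum: "(\<Sum>i<n - 1. slack i) = 0" and "weight (x 0) + weight (x (n - 1)) = 1"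
    using end_weights sum_slack_nonneg by linarith+
  then have ends: "x 0 = k \<or> x (n - 1) = k"
    using weight_nonneg[of "x 0"] weight_nonneg[of "x (n - 1)"]
      weight_eq_0_iff[of "x 0"] weight_eq_0_iff[of "x (n - 1)"] by linarith
  have "\<exists>i<n. x i = 2 * k - 1"
    by (rule x_surj) (use n_even n_ge in linarith)+
  then obtain r where r: "r < n" "x r = 2 * k - 1"
    by blast
  obtain i where i: "r = Suc i" "Suc (Suc i) < n" "side (x i) = 1" "side (x (Suc (Suc i))) = 1"
    using right_between_left[of r] sum ends r side_far_right by auto
  have "slack i + slack (Suc i) \<ge> 1"
    using triple_slack_far_right i r by simp
  then show False
    using sum_slack_mono[of "{i, Suc i}"] i sum by auto
qed

text \<open>The pendant vertex has weight \<open>k - s + 1\<close>, here at least 3.\<close>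

lemma weight_1_cases:
  assumes "s + 2 \<le> k" "weight u = 1"
  shows "u = k - 1 \<or> u = k + 1"
proof (cases "u = n")
  case False
  then have "\<bar>int u - int k\<bar> = 1"
    using assms(2) by (simp add: weight_def foot_def stem_def)
  then show ?thesis
    by linarith
qed (use assms in \<open>simp add: weight_def foot_def stem_def\<close>)

text \<open>If the centre is an end, the triples around \<open>2 * k - 1\<close> and
  \<open>2 * k - 2\<close> both need \<open>k - 1\<close> as an outer vertex, while
  \<open>k - 1\<close> is forced to be the other end. If not, the ends are \<open>k - 1\<close> and
  \<open>k + 1\<close> and no slack is left for the triple around \<open>2 * k - 1\<close>.\<close>

lemma excess_ge_3:
  assumes s: "s + 2 \<le> k"
  shows "(\<Sum>i<n - 1. slack i) + weight (x 0) + weight (x (n - 1)) \<ge> 3"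
proof (rule ccontr)
  assume "\<not> ?thesis"
  then have excess: "(\<Sum>i<n - 1. slack i) + weight (x 0) + weight (x (n - 1)) \<le> 2"
    by linarith
  then have sum: "(\<Sum>i<n - 1. slack i) \<le> 1"
    using end_weights by linarith
  have "\<exists>i<n. x i = 2 * k - 1"
    by (rule x_surj) (use n_even n_ge in linarith)+
  then obtain r where r: "r < n" "x r = 2 * k - 1"
    by blast
  show False
  proof (cases "x 0 = k \<or> x (n - 1) = k")
    case True
    obtain i where i: "r = Suc i" "Suc (Suc i) < n" "side (x i) = 1" "side (x (Suc (Suc i))) = 1"
      using right_between_left[of r] sum True r side_far_right by auto
    have "\<exists>i<n. x i = 2 * k - 2"
      by (rule x_surj) (use n_even n_ge in linarith)+
    then obtain r' where r': "r' < n" "x r' = 2 * k - 2"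
      by blast
    have "side (2 * k - 2) = -1"
      unfolding side_def foot_def sgn_if using s s_ge n_even by auto
    then obtain j where j: "r' = Suc j" "Suc (Suc j) < n" "side (x j) = 1" "side (x (Suc (Suc j))) = 1"
      using right_between_left[of r'] sum True r' by auto
    have weights: "weight (x (Suc i)) = int k - 1" "weight (x (Suc j)) = int k - 2"
      unfolding weight_def foot_def stem_def using r r' i j s s_ge n_even by auto
    have "i \<noteq> j"
      using r r' i j s by auto
    \<comment> \<open>Otherwise a left vertex would coincide with a right one. The two triples thus
      use four different gaps.\<close>
    moreover have "i \<noteq> Suc j" "j \<noteq> Suc i"
      using i j r r' \<open>side (2 * k - 2) = -1\<close> side_far_right by auto
    ultimately have "sum slack {i, Suc i, j, Suc j}
        = (slack i + slack (Suc i)) + (slack j + slack (Suc j))"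
      by simp
    then have total: "(slack i + slack (Suc i)) + (slack j + slack (Suc j)) \<le> (\<Sum>i<n - 1. slack i)"
      using sum_slack_mono[of "{i, Suc i, j, Suc j}"] i j by auto
    have "slack i + slack (Suc i) \<ge> 1"
      using triple_slack_far_right i r by simp
    moreover have "slack j + slack (Suc j) \<ge> 0"
      using slack_nonneg j by simp
    ultimately have tight: "slack i + slack (Suc i) = 1" "slack j + slack (Suc j) = 0"
      and end_sum: "weight (x 0) + weight (x (n - 1)) = 1"
      using total sum excess end_weights by linarith+
    have near: "x i = k - 1 \<or> x (Suc (Suc i)) = k - 1" "x j = k - 1 \<or> x (Suc (Suc j)) = k - 1"
      using i j tight weights by (intro left_neighbour_adjacent_center[OF s]; simp)+
    have not_right: "side (x q) \<noteq> -1" if "q = 0 \<or> q = n - 1" for q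
    proof
      assume "side (x q) = -1"
      moreover have "q < n"
        using that n_ge by auto
      ultimately obtain j where "q = Suc j" "Suc (Suc j) < n"
        using right_between_left[OF sum, of q] True by blast
      then show False
        using that by auto
    qed
    have "side (k + 1) = -1"
      unfolding side_def foot_def sgn_if using s s_ge n_even by auto
    \<comment> \<open>The end other than the centre has weight 1, and \<open>k + 1\<close> is
      excluded because it is right.\<close>
    have "x 0 = k - 1 \<or> x (n - 1) = k - 1"
      using True
    proof
      assume "x 0 = k"
      then show ?thesis
        using end_sum weight_eq_0_iff[of k] weight_1_cases[OF s, of "x (n - 1)"]
          not_right[of "n - 1"] \<open>side (k + 1) = -1\<close> by auto
    next
      assume "x (n - 1) = k"
      then show ?thesis
        using end_sum weight_eq_0_iff[of k] weight_1_cases[OF s, of "x 0"]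
          not_right[of 0] \<open>side (k + 1) = -1\<close> by auto
    qed
    then obtain q where q: "q = 0 \<or> q = n - 1" "x q = k - 1"
      by blast
    then have "q < n"
      using n_ge by auto
    \<comment> \<open>An end of the ordering is an outer vertex of only one triple of consecutive
      vertices, so \<open>i = j\<close>.\<close>
    then have "i = q \<or> Suc (Suc i) = q" "j = q \<or> Suc (Suc j) = q"
      using near x_eq_iff[of _ q] q(2) i j by auto
    then show False
      using q(1) i j \<open>i \<noteq> j\<close> by auto
  next
    case False
    then have "weight (x 0) \<noteq> 0" "weight (x (n - 1)) \<noteq> 0"
      using weight_eq_0_iff by auto
    then have ones: "weight (x 0) = 1" "weight (x (n - 1)) = 1" and zero: "(\<Sum>i<n - 1. slack i) = 0"
      using weight_nonneg[of "x 0"] weight_nonneg[of "x (n - 1)"] sum_slack_nonneg excess by linarith+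
    have "x 0 \<noteq> x (n - 1)"
      using x_eq_iff[of 0 "n - 1"] n_ge by auto
    moreover have "side (k - 1) = 1" "side (k + 1) = -1"
      unfolding side_def foot_def sgn_if using s s_ge n_even by auto
    ultimately have "side (x 0) + side (x (n - 1)) = 0"
      using weight_1_cases[OF s ones(1)] weight_1_cases[OF s ones(2)] by auto
    moreover have "weight (x r) = int k - 1"
      unfolding weight_def foot_def stem_def using r n_even n_ge by auto
    then have "r \<noteq> 0" "r \<noteq> n - 1"
      using ones s s_ge by (intro notI; simp)+
    then have "0 < r \<and> r < n - 1"
      using r by linarith
    ultimately obtain i where i: "r = Suc i" "Suc (Suc i) < n" "side (x i) = 1" "side (x (Suc (Suc i))) = 1"
      using right_between_left[OF sum, of r] r side_far_right by auto
    have "slack i + slack (Suc i) \<ge> 1"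
      using triple_slack_far_right i r by simp
    then show False
      using sum_slack_mono[of "{i, Suc i}"] i zero by auto
  qed
qed

end

section \<open>The radio number\<close>

lemma radio_number_attained:
  assumes "finite V"
  obtains c where "radio_labeling V E c" "label_span V c = radio_number V E"
proof -
  have "\<exists>m c. radio_labeling V E c \<and> label_span V c = m"
    using radio_labeling_exists[OF assms] by blast
  then have "\<exists>c. radio_labeling V E c \<and> label_span V c = radio_number V E"
    unfolding radio_number_def by (rule LeastI_ex)
  then show thesis
    using that by blast
qed

text \<open>The vertices are sorted by the labels of an optimal labeling; the last label is then at
  most the span.\<close>

lemma spire_ordering_exists:
  assumes "n \<ge> 4" "2 \<le> s" "s \<le> k" "n = 2 * k \<or> n = 2 * k + 1"
  obtains x c where "spire_ordering n s k x c"
    "c (x (n - 1)) \<le> int (radio_number (spire_verts n) (spire_edges n s))"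
proof -
  let ?V = "spire_verts n" and ?E = "spire_edges n s"
  have s: "s \<le> n - 2"
    using assms by auto
  obtain c where c: "radio_labeling ?V ?E c" "label_span ?V c = radio_number ?V ?E"
    using radio_number_attained[of ?V ?E] by (auto simp: spire_verts_def)
  define xs where "xs = sort_key c [1..<Suc n]"
  have len: "length xs = n" and set: "set xs = {1..n}"
    by (auto simp: xs_def)
  have "bij_betw ((!) xs) {..<n} {1..n}"
    using bij_betw_nth[of xs "{..<n}" "{1..n}"] len set by (simp add: xs_def)
  moreover have "spire_ordering n s k ((!) xs) (\<lambda>u. int (c u))"
  proof
    show "n \<ge> 4" "2 \<le> s" "s \<le> k" "n = 2 * k \<or> n = 2 * k + 1"
      by (fact assms)+
    show bij: "bij_betw ((!) xs) {..<n} {1..n}"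
      by fact
    then have mem: "xs ! i \<in> ?V" if "i < n" for i
      using that by (auto simp: bij_betw_def spire_verts_def)
    show "int (c (xs ! 0)) \<ge> 1"
      using c(1) mem[of 0] assms(1) by (force simp: radio_labeling_def)
    fix i j
    assume ij: "i < j" "j < n"
    have "sorted (map c xs)"
      by (simp add: xs_def)
    then have mono: "c (xs ! i) \<le> c (xs ! j)"
      using sorted_nth_mono[of "map c xs" i j] ij len by simp
    have "xs ! i \<noteq> xs ! j"
      using bij ij by (auto simp: bij_betw_def inj_on_def)
    then have "int (graph_dist ?E (xs ! i) (xs ! j)) + \<bar>int (c (xs ! i)) - int (c (xs ! j))\<bar>
        \<ge> int (graph_diam ?V ?E) + 1"
      using c(1) mem ij by (simp add: radio_labeling_def)
    then show "int (c (xs ! j)) - int (c (xs ! i)) \<ge> int n - 1 - spire_dist n s (xs ! i) (xs ! j)"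
      using mono spire_diam_ge[OF assms(1,2) s]
        graph_dist_le_spire_dist[OF assms(2) s mem[of i] mem[of j]] ij by linarith
  qed
  moreover have "xs ! (n - 1) \<in> ?V"
    using calculation(1) assms(1) by (auto simp: bij_betw_def spire_verts_def)
  then have "c (xs ! (n - 1)) \<le> radio_number ?V ?E"
    unfolding c(2)[symmetric] label_span_def by (intro Max_ge) (auto simp: spire_verts_def)
  ultimately show thesis
    using that by auto
qed

theorem mainTheorem3:
  fixes n s :: nat
  assumes "n \<ge> 4" and "2 \<le> s" and "s \<le> n div 2"
  shows "\<forall>k::nat.
      (n = 2 * k \<and> 2 \<le> s \<and> s + 2 \<le> k \<longrightarrow>
         int (radio_number (spire_verts n) (spire_edges n s))
           \<ge> 2 * int k ^ 2 - 4 * int k + 2 * int s + 3) \<and>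
      (n = 2 * k \<and> s + 1 = k \<longrightarrow>
         int (radio_number (spire_verts n) (spire_edges n s))
           \<ge> 2 * int k ^ 2 - 2 * int k) \<and>
      (n = 2 * k \<and> s = k \<longrightarrow>
         int (radio_number (spire_verts n) (spire_edges n s))
           \<ge> 2 * int k ^ 2 - 2 * int k + 1) \<and>
      (n = 2 * k + 1 \<longrightarrow>
         int (radio_number (spire_verts n) (spire_edges n s))
           \<ge> 2 * int k ^ 2 - 2 * int k + 2 * int s)"
proof
  fix k :: nat
  let ?rn = "int (radio_number (spire_verts n) (spire_edges n s))"
  \<comment> \<open>The constants 3, 2 and 1 are the lower bounds for the excess. Substituting
    \<open>s = k - 1\<close> and \<open>s = k\<close> gives the second and third case of the
    theorem.\<close>
  have even: "?rn \<ge> 2 * int k ^ 2 - 4 * int k + 2 * int s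
      + (if s + 2 \<le> k then 3 else if s < k then 2 else 1)" if n: "n = 2 * k"
  proof -
    obtain x c where "spire_ordering n s k x c" and rn: "c (x (n - 1)) \<le> ?rn"
      using spire_ordering_exists[of n s k] assms n by auto
    then interpret spire_ordering n s k x c
      by simp
    have "even_spire_ordering n s k x c" if "s < k"
      by standard (use n that in auto)
    then show ?thesis
      using even_spire_ordering.excess_ge_2[of n s k x c] even_spire_ordering.excess_ge_3[of n s k x c]
        end_weights sum_slack_nonneg last_label_even[OF n] rn by auto
  qed
  have odd: "?rn \<ge> 2 * int k ^ 2 - 2 * int k + 2 * int s" if n: "n = 2 * k + 1"
  proof -
    obtain x c where "spire_ordering n s k x c" and rn: "c (x (n - 1)) \<le> ?rn"
      using spire_ordering_exists[of n s k] assms n by auto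
    then show ?thesis
      using spire_ordering.last_label_odd[of n s k x c] n by auto
  qed
  show "(n = 2 * k \<and> 2 \<le> s \<and> s + 2 \<le> k \<longrightarrow> ?rn \<ge> 2 * int k ^ 2 - 4 * int k + 2 * int s + 3) \<and>
      (n = 2 * k \<and> s + 1 = k \<longrightarrow> ?rn \<ge> 2 * int k ^ 2 - 2 * int k) \<and>
      (n = 2 * k \<and> s = k \<longrightarrow> ?rn \<ge> 2 * int k ^ 2 - 2 * int k + 1) \<and>
      (n = 2 * k + 1 \<longrightarrow> ?rn \<ge> 2 * int k ^ 2 - 2 * int k + 2 * int s)"
    using even odd by auto
qed

end
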